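(* Let $\sigma>0$, $t\ge 1$, $K\ge 2$, let $y_i=x_i+\epsilon_i$ ($1\le i\le n$) with $\epsilon_1,\dots,\epsilon_n$ i.i.d. $N(0,\sigma^2)$, where $(x_i)_{i=1}^n$ is constant on each of the $K$ intervals $\{n_k,\dots,n_{k+1}-1\}$, $1\le k\le K$. Let $M_y=2\sigma\sqrt{\log n+\log t}$, $W_n=\min_{1\le k\le K}(n_{k+1}-n_k)$ and $H_n=\min_{1\le k\le K-1}|x_{n_k}-x_{n_{k+1}}|$. Assume $H_n\sqrt{W_n}>16M_y$, and define $C>2$ by $H_n\sqrt{W_n}=8CM_y$. Let $\lambda=(C-1)M_y\sqrt{W_n}$ and let $(\hat x_i)_{i=1}^n$ be the minimizer of $$\sum_{i=1}^n(x_i-y_i)^2+\lambda\sum_{i=1}^{n-1}|x_i-x_{i+1}|$$ over $\mathbb{R}^n$. Let $S=\{n_2,\dots,n_K\}$ and $$\hat S=\left\{i:\ \left|\hat x_{i-W_n/(4C^2)}-\hat x_{i+W_n/(4C^2)}\right|>\frac{H_n}{2}\right\}.$$ Then with probability at least $1-1/t^2$, $$d_H(\hat S,S)\le \frac{W_n}{2C^2}=\frac{32M_y^2}{H_n^2}.$$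
   Context: The true signal $(x_i)_{i=1}^n\in\mathbb{R}^n$ is deterministic and piecewise constant with $K$ pieces: there are integers $1=n_1<n_2<\dots<n_K<n$, with $n_{K+1}=n+1$, such that $x_{n_k}=x_{n_k+1}=\dots=x_{n_{k+1}-1}$ for each $1\le k\le K$. In the optimization problem the symbols $x_i$ denote the optimization variables. $M_y>0$ is assumed, so that $C$ is well defined. The quantity $W_n/(4C^2)$ is used as an index shift, so it is understood to be a positive integer, and in $\hat S$ the index $i$ ranges over those integers for which both $i-W_n/(4C^2)$ and $i+W_n/(4C^2)$ lie in $\{1,\dots,n\}$. For sets $A,B$ of integers, $d_H(A,B)=\max(d(A,B),d(B,A))$ with $d(A,B)=\max_{b\in B}\min_{a\in A}|a-b|$; the conclusion includes that $\hat S$ is nonempty. *)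

theory Defs
  imports "HOL-Probability.Probability"
begin

text \<open>
  A vector of \<open>\<real>\<^sup>n\<close> is a function in \<open>{1..n} \<rightarrow>\<^sub>E UNIV\<close>. The change points are
  \<open>\<nu> 1 < \<dots> < \<nu> K\<close>, and \<open>\<nu> (K + 1) = n + 1\<close> is the end sentinel.
\<close>

definition piecewise_constant :: "nat \<Rightarrow> nat \<Rightarrow> (nat \<Rightarrow> nat) \<Rightarrow> (nat \<Rightarrow> real) \<Rightarrow> bool" where
  "piecewise_constant n K \<nu> x \<longleftrightarrow>
     \<nu> 1 = 1 \<and> strict_mono_on {1..K} \<nu> \<and> \<nu> K < n \<and> \<nu> (K + 1) = n + 1 \<and>
     (\<forall>k\<in>{1..K}. \<forall>i\<in>{\<nu> k..<\<nu> (k + 1)}. x i = x (\<nu> k))"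

definition min_piece_length :: "nat \<Rightarrow> (nat \<Rightarrow> nat) \<Rightarrow> nat" where
  "min_piece_length K \<nu> = Min ((\<lambda>k. \<nu> (k + 1) - \<nu> k) ` {1..K})"

definition min_jump :: "nat \<Rightarrow> (nat \<Rightarrow> nat) \<Rightarrow> (nat \<Rightarrow> real) \<Rightarrow> real" where
  "min_jump K \<nu> x = Min ((\<lambda>k. \<bar>x (\<nu> k) - x (\<nu> (k + 1))\<bar>) ` {1..K - 1})"

definition tv_objective :: "nat \<Rightarrow> real \<Rightarrow> (nat \<Rightarrow> real) \<Rightarrow> (nat \<Rightarrow> real) \<Rightarrow> real" where
  "tv_objective n lam y z =
     (\<Sum>i=1..n. (z i - y i)\<^sup>2) + lam * (\<Sum>i=1..<n. \<bar>z i - z (i + 1)\<bar>)"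

text \<open>
  For \<open>lam \<ge> 0\<close> the objective is strictly convex and coercive on \<open>\<real>\<^sup>n\<close>, so the choice
  made by \<^const>\<open>arg_min\<close> is the unique minimizer.
\<close>

definition tv_minimizer :: "nat \<Rightarrow> real \<Rightarrow> (nat \<Rightarrow> real) \<Rightarrow> (nat \<Rightarrow> real)" where
  "tv_minimizer n lam y = arg_min (tv_objective n lam y) (\<lambda>z. z \<in> {1..n} \<rightarrow>\<^sub>E UNIV)"

text \<open>
  The guard \<open>r < i\<close> says that \<open>i - r \<ge> 1\<close>; it also rules out truncated subtraction.
\<close>

definition est_change_points :: "nat \<Rightarrow> nat \<Rightarrow> real \<Rightarrow> (nat \<Rightarrow> real) \<Rightarrow> nat set" where
  "est_change_points n r h z = {i. r < i \<and> i + r \<le> n \<and> \<bar>z (i - r) - z (i + r)\<bar> > h}"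

text \<open>
  The one-sided distance is not symmetric: the maximum is over the second set.
  Both distances are meaningful only for finite nonempty sets.
\<close>

definition one_sided_dist :: "nat set \<Rightarrow> nat set \<Rightarrow> real" where
  "one_sided_dist A B = Max ((\<lambda>b. Min ((\<lambda>a. \<bar>real a - real b\<bar>) ` A)) ` B)"

definition hausdorff_dist :: "nat set \<Rightarrow> nat set \<Rightarrow> real" where
  "hausdorff_dist A B = max (one_sided_dist A B) (one_sided_dist B A)"

end

theory Submission
  imports Defs
begin

text \<open>
  A minimizer \<open>z\<close> of the objective satisfies a local optimality condition. Fix an index \<open>i\<close> in a
  piece \<open>{a..b}\<close> and let \<open>{p..q} \<subseteq> {a..b}\<close> be the longest interval around \<open>i\<close> on which \<open>z\<close> is at
  least \<open>z i\<close>. Lowering \<open>z\<close> by a small amount on \<open>{p..q}\<close> cannot decrease the objective. An end of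
  \<open>{p..q}\<close> strictly inside the piece lies above its outer neighbour, so there the lowering reduces
  the variation; an end shared with the piece may increase it, and an end shared with \<open>{1..n}\<close> has
  no effect. Hence \<open>z i\<close> is at most the average of \<open>y\<close> over \<open>{p..q}\<close> plus a correction of order
  \<open>lam\<close> divided by the length, which is negative when \<open>{p..q}\<close> stays away from the ends of the piece
  (\<open>tv_local_average_bound\<close>).

  If every sum of the noise over an interval of length \<open>L\<close> is at most \<open>m * sqrt L\<close> in absolute value,
  then an index at distance \<open>d \<le> 4 * r\<close> from the ends of its piece is estimated with error at most
  \<open>m / sqrt d\<close> (\<open>tv_piece_bound\<close>): an interval that is not the whole piece either gains from the
  penalty or has length at least \<open>d\<close>, and on the whole piece noise and penalty together cost at most
  \<open>C * m / sqrt W = m / (2 * sqrt r)\<close>. The radius \<open>r\<close> is chosen so that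
  \<open>m / sqrt r = H / 4\<close>. Across a change point, values at distance \<open>r\<close> on either side therefore
  differ by more than \<open>H - H / 2\<close>, and every true change point is itself detected. An index farther
  than \<open>2 * r\<close> from all change points sees two values from deep inside the same piece, which
  differ by less than \<open>H / 2\<close>, so it is not detected (\<open>change_point_recovery\<close>).

  The noise condition holds with probability at least \<open>1 - 1 / t\<^sup>2\<close> (\<open>interval_noise_bound\<close>): an
  interval sum is normal, each violation has probability at most \<open>1 / (n * t)\<^sup>2\<close>, and there are at
  most \<open>n\<^sup>2\<close> intervals. The event in the conclusion is measurable because the minimizer depends on the
  data in a Lipschitz way (\<open>tv_minimizer_lipschitz\<close>).
\<close>

section \<open>Existence and measurability of the minimizer\<close>

lemma tv_objective_cong:
  assumes "\<And>i. i \<in> {1..n} \<Longrightarrow> z i = z' i" "\<And>i. i \<in> {1..n} \<Longrightarrow> y i = y' i"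
  shows "tv_objective n lam y z = tv_objective n lam y' z'"
proof -
  have "(\<Sum>i=1..n. (z i - y i)\<^sup>2) = (\<Sum>i=1..n. (z' i - y' i)\<^sup>2)"
    using assms by (intro sum.cong) auto
  moreover have "(\<Sum>i=1..<n. \<bar>z i - z (i + 1)\<bar>) = (\<Sum>i=1..<n. \<bar>z' i - z' (i + 1)\<bar>)"
    using assms(1) by (intro sum.cong) auto
  ultimately show ?thesis
    unfolding tv_objective_def by (simp only:)
qed

lemma tv_objective_uminus: "tv_objective n lam (- y) (- z) = tv_objective n lam y z"
proof -
  have "(- z i - - y i)\<^sup>2 = (z i - y i)\<^sup>2" for i
    by (simp add: power2_eq_square algebra_simps)
  moreover have "\<bar>- z i - - z (i + 1)\<bar> = \<bar>z i - z (i + 1)\<bar>" for i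
    by linarith
  ultimately show ?thesis
    unfolding tv_objective_def by simp
qed

text \<open>
  The objective exceeds its value at \<open>y\<close> as soon as one coordinate is far from \<open>y\<close>, so the search
  can be restricted to a box, which is compact by Tychonoff's theorem.
\<close>

lemma tv_minimizer_is_arg_min:
  assumes "0 \<le> lam"
  shows "is_arg_min (tv_objective n lam y) (\<lambda>z. z \<in> {1..n} \<rightarrow>\<^sub>E UNIV) (tv_minimizer n lam y)"
proof -
  let ?f = "tv_objective n lam y"
  define y0 where "y0 = restrict y {1..n}"
  \<comment> \<open>If \<open>\<bar>w i - y i\<bar> > B\<close> then the quadratic term alone exceeds the objective at \<open>y\<close>.\<close>
  define B where "B = sqrt (?f y)"
  define Box :: "(nat \<Rightarrow> real) set"
    where "Box = (\<Pi>\<^sub>E i\<in>UNIV. if i \<in> {1..n} then {y i - B..y i + B} else {undefined})"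
  have f_y_nonneg: "0 \<le> ?f y"
    unfolding tv_objective_def using assms by (simp add: sum_nonneg)
  have y0: "?f y0 = ?f y"
    by (intro tv_objective_cong) (auto simp: y0_def)
  have "compactin (product_topology (\<lambda>_. euclidean) UNIV) Box"
    unfolding Box_def by (subst compactin_PiE) auto
  then have "compact Box"
    by (simp add: euclidean_product_topology)
  moreover have "y0 \<in> Box"
    using f_y_nonneg by (auto simp: Box_def y0_def B_def PiE_def)
  moreover have "continuous_on Box ?f"
    unfolding tv_objective_def
    by (intro continuous_intros continuous_on_subset[OF continuous_on_product_coordinates]) auto
  ultimately obtain z where z: "z \<in> Box" "\<And>w. w \<in> Box \<Longrightarrow> ?f z \<le> ?f w"
    using continuous_attains_inf[of Box ?f] by blast
  have "?f z \<le> ?f w" if w: "w \<in> {1..n} \<rightarrow>\<^sub>E UNIV" for w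
  proof (cases "w \<in> Box")
    case False
    then obtain i where i: "w i \<notin> (if i \<in> {1..n} then {y i - B..y i + B} else {undefined})"
      by (auto simp: Box_def PiE_iff)
    moreover from this have "i \<in> {1..n}"
      using w PiE_arb[OF w, of i] by (auto split: if_splits)
    ultimately have i: "i \<in> {1..n}" "w i \<notin> {y i - B..y i + B}"
      by simp_all
    then have "B < \<bar>w i - y i\<bar>"
      by auto
    then have "B\<^sup>2 \<le> (w i - y i)\<^sup>2"
      using f_y_nonneg by (intro abs_le_square_iff[THEN iffD1]) (simp add: B_def)
    then have "?f y \<le> (w i - y i)\<^sup>2"
      using f_y_nonneg by (simp add: B_def)
    also have "\<dots> \<le> (\<Sum>i=1..n. (w i - y i)\<^sup>2)"
      using i by (intro member_le_sum) auto
    also have "\<dots> \<le> ?f w"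
      unfolding tv_objective_def using assms by (simp add: sum_nonneg)
    finally show ?thesis
      using z(2)[OF \<open>y0 \<in> Box\<close>] y0 by simp
  qed (use z in auto)
  moreover have "z \<in> {1..n} \<rightarrow>\<^sub>E UNIV"
    using z(1) by (fastforce simp: Box_def PiE_def extensional_def Pi_def split: if_splits)
  ultimately have "is_arg_min ?f (\<lambda>z. z \<in> {1..n} \<rightarrow>\<^sub>E UNIV) z"
    by (simp add: is_arg_min_linorder)
  from someI[of "is_arg_min ?f (\<lambda>z. z \<in> {1..n} \<rightarrow>\<^sub>E UNIV)", OF this] show ?thesis
    unfolding tv_minimizer_def arg_min_def .
qed

lemma tv_minimizer_le:
  assumes "0 \<le> lam"
  shows "tv_objective n lam y (tv_minimizer n lam y) \<le> tv_objective n lam y w"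
proof -
  have "tv_objective n lam y (tv_minimizer n lam y) \<le> tv_objective n lam y (restrict w {1..n})"
    using tv_minimizer_is_arg_min[OF assms, of n y] by (simp add: is_arg_min_linorder)
  also have "\<dots> = tv_objective n lam y w"
    by (intro tv_objective_cong) auto
  finally show ?thesis .
qed

text \<open>
  The quadratic part is strongly convex and the penalty is convex, so comparing \<open>z\<close> with the midpoint
  of \<open>z\<close> and \<open>w\<close> gives a quadratic gain. The constant \<open>1 / 2\<close>, half of the optimal one, is what the
  midpoint yields without passing to a limit.
\<close>

lemma tv_objective_strong_convexity:
  assumes "0 \<le> lam"
    and min: "\<And>w. tv_objective n lam y z \<le> tv_objective n lam y w"
  shows "tv_objective n lam y z + (\<Sum>i=1..n. (w i - z i)\<^sup>2) / 2 \<le> tv_objective n lam y w"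
proof -
  define m where "m = (\<lambda>i. (z i + w i) / 2)"
  have "(m i - y i)\<^sup>2 = (z i - y i)\<^sup>2 / 2 + (w i - y i)\<^sup>2 / 2 - (w i - z i)\<^sup>2 / 4" for i
    unfolding m_def by (simp add: power2_eq_square field_simps)
  then have sq: "(\<Sum>i=1..n. (m i - y i)\<^sup>2) = (\<Sum>i=1..n. (z i - y i)\<^sup>2) / 2
      + (\<Sum>i=1..n. (w i - y i)\<^sup>2) / 2 - (\<Sum>i=1..n. (w i - z i)\<^sup>2) / 4"
    by (simp add: sum.distrib sum_subtractf sum_divide_distrib)
  have "(\<Sum>i=1..<n. \<bar>m i - m (i + 1)\<bar>)
      \<le> (\<Sum>i=1..<n. \<bar>z i - z (i + 1)\<bar> / 2 + \<bar>w i - w (i + 1)\<bar> / 2)"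
    unfolding m_def by (intro sum_mono) (simp add: abs_if field_simps)
  also have "\<dots> = (\<Sum>i=1..<n. \<bar>z i - z (i + 1)\<bar>) / 2 + (\<Sum>i=1..<n. \<bar>w i - w (i + 1)\<bar>) / 2"
    by (simp add: sum.distrib sum_divide_distrib)
  finally have "lam * (\<Sum>i=1..<n. \<bar>m i - m (i + 1)\<bar>)
      \<le> lam * ((\<Sum>i=1..<n. \<bar>z i - z (i + 1)\<bar>) / 2 + (\<Sum>i=1..<n. \<bar>w i - w (i + 1)\<bar>) / 2)"
    using assms(1) by (rule mult_left_mono)
  then have "tv_objective n lam y m \<le> tv_objective n lam y z / 2 + tv_objective n lam y w / 2
      - (\<Sum>i=1..n. (w i - z i)\<^sup>2) / 4"
    unfolding tv_objective_def sq by (simp add: field_simps)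
  with min[of m] show ?thesis
    by simp
qed

text \<open>
  Each minimizer is inserted as a competitor into the other problem. On adding the two growth
  inequalities the penalties cancel, and the cross terms that remain are absorbed by Young's inequality.
\<close>

lemma tv_minimizer_lipschitz:
  assumes "0 \<le> lam"
  shows "(\<Sum>i=1..n. (tv_minimizer n lam y i - tv_minimizer n lam y' i)\<^sup>2)
    \<le> 4 * (\<Sum>i=1..n. (y i - y' i)\<^sup>2)"
proof -
  let ?f = "tv_objective n lam"
  define z z' where "z = tv_minimizer n lam y" and "z' = tv_minimizer n lam y'"
  have *: "?f y z + (\<Sum>i=1..n. (z' i - z i)\<^sup>2) / 2 \<le> ?f y z'"
    "?f y' z' + (\<Sum>i=1..n. (z i - z' i)\<^sup>2) / 2 \<le> ?f y' z"
    unfolding z_def z'_def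
    by (intro tv_objective_strong_convexity assms tv_minimizer_le[OF assms])+
  have "(\<Sum>i=1..n. (z i - z' i)\<^sup>2) \<le> ?f y z' - ?f y z + ?f y' z - ?f y' z'"
    using * by (simp add: power2_commute)
  also have "\<dots> = (\<Sum>i=1..n. (z' i - y i)\<^sup>2 - (z i - y i)\<^sup>2 + (z i - y' i)\<^sup>2 - (z' i - y' i)\<^sup>2)"
    unfolding tv_objective_def by (simp add: sum.distrib sum_subtractf)
  also have "\<dots> \<le> (\<Sum>i=1..n. (z i - z' i)\<^sup>2 / 2 + 2 * (y i - y' i)\<^sup>2)"
  proof (rule sum_mono)
    fix i
    \<comment> \<open>Expanding this square is Young's inequality for \<open>2 * (z' i - z i) * (y' i - y i)\<close>.\<close>
    have "0 \<le> (z i - z' i - 2 * (y i - y' i))\<^sup>2"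
      by simp
    then show "(z' i - y i)\<^sup>2 - (z i - y i)\<^sup>2 + (z i - y' i)\<^sup>2 - (z' i - y' i)\<^sup>2
        \<le> (z i - z' i)\<^sup>2 / 2 + 2 * (y i - y' i)\<^sup>2"
      by (simp add: power2_eq_square algebra_simps diff_divide_distrib add_divide_distrib)
  qed
  finally have "(\<Sum>i=1..n. (z i - z' i)\<^sup>2)
      \<le> (\<Sum>i=1..n. (z i - z' i)\<^sup>2) / 2 + 2 * (\<Sum>i=1..n. (y i - y' i)\<^sup>2)"
    by (simp add: sum.distrib sum_distrib_left sum_divide_distrib)
  then show ?thesis
    unfolding z_def z'_def by linarith
qed

text \<open>
  Continuity is with respect to the product topology on \<open>nat \<Rightarrow> real\<close>; the Lipschitz estimate suffices
  because it involves only the finitely many coordinates in \<open>{1..n}\<close>.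
\<close>

lemma continuous_tv_minimizer:
  assumes "0 \<le> lam" "i \<in> {1..n}"
  shows "continuous_on UNIV (\<lambda>y. tv_minimizer n lam y i)"
  unfolding continuous_on_def
proof (intro ballI)
  fix y :: "nat \<Rightarrow> real"
  define g where "g = (\<lambda>y'. sqrt (4 * (\<Sum>i=1..n. (y' i - y i)\<^sup>2)))"
  have "continuous_on UNIV g"
    unfolding g_def by (intro continuous_intros continuous_on_product_coordinates)
  then have "(g \<longlongrightarrow> g y) (at y)"
    by (simp add: continuous_on_def)
  then have lim: "(g \<longlongrightarrow> 0) (at y)"
    by (simp add: g_def)
  have "norm (tv_minimizer n lam y' i - tv_minimizer n lam y i) \<le> g y'" for y'
  proof -
    have "(tv_minimizer n lam y' i - tv_minimizer n lam y i)\<^sup>2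
        \<le> (\<Sum>i=1..n. (tv_minimizer n lam y' i - tv_minimizer n lam y i)\<^sup>2)"
      using assms(2) by (intro member_le_sum) auto
    also have "\<dots> \<le> 4 * (\<Sum>i=1..n. (y' i - y i)\<^sup>2)"
      by (rule tv_minimizer_lipschitz[OF assms(1)])
    finally show ?thesis
      unfolding g_def by (metis real_norm_def real_sqrt_abs real_sqrt_le_iff)
  qed
  then have "\<forall>\<^sub>F y' in at y. norm (tv_minimizer n lam y' i - tv_minimizer n lam y i) \<le> g y'"
    by simp
  then have "((\<lambda>y'. tv_minimizer n lam y' i - tv_minimizer n lam y i) \<longlongrightarrow> 0) (at y)"
    using lim by (rule Lim_null_comparison)
  then show "((\<lambda>y. tv_minimizer n lam y i) \<longlongrightarrow> tv_minimizer n lam y i) (at y within UNIV)"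
    by (simp add: LIM_zero_cancel)
qed

lemma measurable_tv_minimizer:
  assumes "0 \<le> lam" "i \<in> {1..n}"
    and meas: "\<And>j. j \<in> {1..n} \<Longrightarrow> (\<lambda>\<omega>. y \<omega> j) \<in> borel_measurable M"
  shows "(\<lambda>\<omega>. tv_minimizer n lam (y \<omega>) i) \<in> borel_measurable M"
proof -
  \<comment> \<open>Coordinates outside \<open>{1..n}\<close> do not affect the minimizer but need not be measurable.\<close>
  define y0 where "y0 = (\<lambda>\<omega> j. if j \<in> {1..n} then y \<omega> j else 0)"
  have "tv_objective n lam (y0 \<omega>) = tv_objective n lam (y \<omega>)" for \<omega>
    by (intro ext tv_objective_cong) (auto simp: y0_def)
  then have eq: "tv_minimizer n lam (y0 \<omega>) = tv_minimizer n lam (y \<omega>)" for \<omega>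
    by (simp add: tv_minimizer_def)
  have "(\<lambda>\<omega>. y0 \<omega> j) \<in> borel_measurable M" for j
    using meas[of j] by (cases "j \<in> {1..n}") (simp_all add: y0_def del: atLeastAtMost_iff)
  then have "y0 \<in> borel_measurable M"
    by (rule measurable_coordinatewise_then_product)
  from measurable_compose[OF this
      borel_measurable_continuous_onI[OF continuous_tv_minimizer[OF assms(1,2)]]]
  show ?thesis
    by (simp add: eq)
qed

text \<open>
  The estimate takes values among the finitely many subsets of \<open>{..n}\<close>, so any property of it gives a
  measurable event once membership of each index does.
\<close>

lemma measurable_est_change_points:
  assumes "0 \<le> lam"
    and meas: "\<And>j. j \<in> {1..n} \<Longrightarrow> (\<lambda>\<omega>. y \<omega> j) \<in> borel_measurable M"
  shows "{\<omega> \<in> space M. P (est_change_points n r h (tv_minimizer n lam (y \<omega>)))} \<in> sets M"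
proof -
  define E where "E = (\<lambda>\<omega>. est_change_points n r h (tv_minimizer n lam (y \<omega>)))"
  have mem: "{\<omega> \<in> space M. i \<in> E \<omega>} \<in> sets M" for i
  proof (cases "r < i \<and> i + r \<le> n")
    case True
    then have [measurable]: "(\<lambda>\<omega>. tv_minimizer n lam (y \<omega>) (i - r)) \<in> borel_measurable M"
      "(\<lambda>\<omega>. tv_minimizer n lam (y \<omega>) (i + r)) \<in> borel_measurable M"
      by (auto intro!: measurable_tv_minimizer assms)
    have "{\<omega> \<in> space M. i \<in> E \<omega>} = {\<omega> \<in> space M.
        h < \<bar>tv_minimizer n lam (y \<omega>) (i - r) - tv_minimizer n lam (y \<omega>) (i + r)\<bar>}"
      using True by (auto simp: E_def est_change_points_def)
    then show ?thesis
      by simp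
  next
    case False
    then have "i \<notin> E \<omega>" for \<omega>
      by (auto simp: E_def est_change_points_def)
    then show ?thesis
      by simp
  qed
  have sub: "E \<omega> \<subseteq> {..n}" for \<omega>
    by (auto simp: E_def est_change_points_def)
  have "{\<omega> \<in> space M. E \<omega> = A} \<in> sets M" if "A \<subseteq> {..n}" for A
  proof -
    have "{\<omega> \<in> space M. E \<omega> = A} = {\<omega> \<in> space M. \<forall>i\<in>{..n}. i \<in> E \<omega> \<longleftrightarrow> i \<in> A}"
      using sub that by blast
    also have "\<dots> \<in> sets M"
    proof (rule sets.sets_Collect_finite_All)
      show "{\<omega> \<in> space M. i \<in> E \<omega> \<longleftrightarrow> i \<in> A} \<in> sets M" for i
        using mem[of i] sets.sets_Collect_neg[OF mem[of i]] by (cases "i \<in> A") simp_all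
    qed simp
    finally show ?thesis .
  qed
  then have "(\<Union>A\<in>{A \<in> Pow {..n}. P A}. {\<omega> \<in> space M. E \<omega> = A}) \<in> sets M"
    by (intro sets.finite_UN) auto
  also have "(\<Union>A\<in>{A \<in> Pow {..n}. P A}. {\<omega> \<in> space M. E \<omega> = A}) = {\<omega> \<in> space M. P (E \<omega>)}"
    using sub by auto
  finally show ?thesis
    by (simp add: E_def)
qed

section \<open>Local error bounds for the minimizer\<close>

text \<open>
  The two summands on the right are the rates at which the variation grows at the ends of \<open>{p..q}\<close> when
  \<open>z\<close> is lowered on it. At an end inside \<open>{a..b}\<close> maximality puts the outer neighbour strictly below
  \<open>z i\<close>, so the jump shrinks; at an end of \<open>{a..b}\<close> nothing is known about the outer neighbour and the
  jump may grow, unless there is no outer neighbour at all.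
\<close>

lemma tv_local_average_bound:
  fixes y z :: "nat \<Rightarrow> real"
  assumes lam: "0 \<le> lam"
    and min: "\<And>w. tv_objective n lam y z \<le> tv_objective n lam y w"
    and J: "1 \<le> a" "a \<le> i" "i \<le> b" "b \<le> n"
  obtains p q where "a \<le> p" "p \<le> i" "i \<le> q" "q \<le> b"
    and "(\<Sum>j=p..q. z i - y j) \<le> lam / 2 *
      ((if a < p then - 1 else if a = 1 then 0 else 1) + (if q < b then - 1 else if b = n then 0 else 1))"
proof -
  define p where "p = (LEAST p. a \<le> p \<and> p \<le> i \<and> (\<forall>j\<in>{p..i}. z i \<le> z j))"
  define q where "q = (GREATEST q. i \<le> q \<and> q \<le> b \<and> (\<forall>j\<in>{i..q}. z i \<le> z j))"
  have "a \<le> p \<and> p \<le> i \<and> (\<forall>j\<in>{p..i}. z i \<le> z j)"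
    unfolding p_def by (rule LeastI[of _ i]) (use J in auto)
  then have p: "a \<le> p" "p \<le> i" "\<And>j. j \<in> {p..i} \<Longrightarrow> z i \<le> z j"
    by auto
  have "i \<le> q \<and> q \<le> b \<and> (\<forall>j\<in>{i..q}. z i \<le> z j)"
    unfolding q_def by (rule GreatestI_nat[of _ i b]) (use J in auto)
  then have q: "i \<le> q" "q \<le> b" "\<And>j. j \<in> {i..q} \<Longrightarrow> z i \<le> z j"
    by auto
  have left: "z (p - 1) < z i" if "a < p"
  proof (rule ccontr)
    assume "\<not> z (p - 1) < z i"
    moreover have "{p - 1..i} = insert (p - 1) {p..i}"
      using that p(2) by auto
    ultimately have "a \<le> p - 1 \<and> p - 1 \<le> i \<and> (\<forall>j\<in>{p - 1..i}. z i \<le> z j)"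
      using that p by auto
    then have "p \<le> p - 1"
      by (subst (1) p_def) (rule Least_le)
    then show False
      using that by simp
  qed
  have right: "z (q + 1) < z i" if "q < b"
  proof (rule ccontr)
    assume "\<not> z (q + 1) < z i"
    moreover have "{i..q + 1} = insert (q + 1) {i..q}"
      using q(1) by auto
    ultimately have "i \<le> q + 1 \<and> q + 1 \<le> b \<and> (\<forall>j\<in>{i..q + 1}. z i \<le> z j)"
      using that q by auto
    then have "q + 1 \<le> q"
      by (subst (2) q_def) (rule Greatest_le_nat, auto)
    then show False
      by simp
  qed
  have pq: "z i \<le> z j" if "j \<in> {p..q}" for j
    using p(3)[of j] q(3)[of j] that by (cases "j \<le> i") auto
  define eL eR :: real
    where "eL = (if a < p then - 1 else if a = 1 then 0 else 1)"
      and "eR = (if q < b then - 1 else if b = n then 0 else 1)"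
  \<comment> \<open>Lowering by at most \<open>s0\<close> keeps the block above its outer neighbours inside \<open>{a..b}\<close>.\<close>
  define s0 where "s0 = min (if a < p then z i - z (p - 1) else 1) (if q < b then z i - z (q + 1) else 1)"
  have s0: "0 < s0"
    using left right by (simp add: s0_def)
  have perturb: "0 \<le> - 2 * (\<Sum>j=p..q. z j - y j) + s * card {p..q} + lam * (eL + eR)"
    if s: "0 < s" "s \<le> s0" for s
  proof -
    define w where "w = (\<lambda>j. if j \<in> {p..q} then z j - s else z j)"
    have sub: "{p..q} \<subseteq> {1..n}"
      using J p q by auto
    have "(\<Sum>j=1..n. (w j - y j)\<^sup>2)
        = (\<Sum>j=1..n. (z j - y j)\<^sup>2 + (if j \<in> {p..q} then - 2 * s * (z j - y j) + s\<^sup>2 else 0))"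
      by (intro sum.cong) (auto simp: w_def power2_eq_square algebra_simps)
    also have "\<dots> = (\<Sum>j=1..n. (z j - y j)\<^sup>2) + (\<Sum>j\<in>{p..q}. - 2 * s * (z j - y j) + s\<^sup>2)"
      using sub by (simp add: sum.distrib sum.inter_restrict[symmetric] Int_absorb1
          del: atLeastAtMost_iff Int_atLeastAtMost)
    also have "(\<Sum>j\<in>{p..q}. - 2 * s * (z j - y j) + s\<^sup>2)
        = s * (- 2 * (\<Sum>j=p..q. z j - y j) + s * card {p..q})"
      unfolding sum.distrib sum_distrib_left[symmetric] sum_constant
      by (simp add: power2_eq_square algebra_simps del: card_atLeastAtMost)
    finally have sq: "(\<Sum>j=1..n. (w j - y j)\<^sup>2) = (\<Sum>j=1..n. (z j - y j)\<^sup>2)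
        + s * (- 2 * (\<Sum>j=p..q. z j - y j) + s * card {p..q})" .
    have "(\<Sum>j=1..<n. \<bar>w j - w (j + 1)\<bar>) \<le> (\<Sum>j=1..<n. \<bar>z j - z (j + 1)\<bar>
        + ((if j = p - 1 then s * eL else 0) + (if j = q then s * eR else 0)))"
    proof (rule sum_mono)
      fix j assume j: "j \<in> {1..<n}"
      consider "j = p - 1" | "j = q" | "j \<noteq> p - 1" "j \<noteq> q"
        by blast
      then show "\<bar>w j - w (j + 1)\<bar> \<le> \<bar>z j - z (j + 1)\<bar>
          + ((if j = p - 1 then s * eL else 0) + (if j = q then s * eR else 0))"
      proof cases
        case 1
        then have eq: "w j = z j" "w (j + 1) = z p - s" "j + 1 = p" "j \<noteq> q"
          using j p q by (auto simp: w_def)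
        show ?thesis
        proof (cases "a < p")
          case True
          then have "z j \<le> z i - s" "z i \<le> z p"
            using 1 s pq[of p] p q by (auto simp: s0_def)
          then show ?thesis
            using True 1 eq s by (simp add: eL_def)
        next
          case False
          then have "a \<noteq> 1"
            using eq j p by auto
          then show ?thesis
            using False 1 eq s by (simp add: eL_def)
        qed
      next
        case 2
        then have eq: "w j = z q - s" "w (j + 1) = z (q + 1)" "j \<noteq> p - 1"
          using j p q by (auto simp: w_def)
        show ?thesis
        proof (cases "q < b")
          case True
          then have "z (q + 1) \<le> z i - s" "z i \<le> z q"
            using s pq[of q] p q by (auto simp: s0_def)
          then show ?thesis
            using True 2 eq s by (simp add: eR_def)
        next
          case False
          then have "b \<noteq> n"
            using 2 j q by auto
          then show ?thesis
            using False 2 eq s by (simp add: eR_def)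
        qed
      next
        case 3
        then have "j \<in> {p..q} \<longleftrightarrow> j + 1 \<in> {p..q}"
          by auto
        then show ?thesis
          using 3 by (auto simp: w_def)
      qed
    qed
    also have "\<dots> \<le> (\<Sum>j=1..<n. \<bar>z j - z (j + 1)\<bar>) + s * (eL + eR)"
    proof -
      have "(\<Sum>j=1..<n. if j = p - 1 then s * eL else 0) = s * eL"
        using J p q by (cases "p = 1") (auto simp: eL_def)
      moreover have "(\<Sum>j=1..<n. if j = q then s * eR else 0) = s * eR"
        using J p q by (cases "q = n") (auto simp: eR_def)
      ultimately show ?thesis
        by (simp add: sum.distrib algebra_simps)
    qed
    finally have "lam * (\<Sum>j=1..<n. \<bar>w j - w (j + 1)\<bar>)
        \<le> lam * ((\<Sum>j=1..<n. \<bar>z j - z (j + 1)\<bar>) + s * (eL + eR))"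
      using lam by (rule mult_left_mono)
    then have "0 \<le> s * (- 2 * (\<Sum>j=p..q. z j - y j) + s * card {p..q} + lam * (eL + eR))"
      using min[of w] unfolding tv_objective_def sq by (simp add: algebra_simps)
    then show ?thesis
      using s(1) by (simp add: zero_le_mult_iff)
  qed
  \<comment> \<open>Letting \<open>s\<close> tend to \<open>0\<close> removes the second-order term.\<close>
  have "((\<lambda>s::real. - 2 * (\<Sum>j=p..q. z j - y j) + s * card {p..q} + lam * (eL + eR))
      \<longlongrightarrow> - 2 * (\<Sum>j=p..q. z j - y j) + 0 * real (card {p..q}) + lam * (eL + eR)) (at_right 0)"
    by (intro tendsto_intros)
  moreover have "\<forall>\<^sub>F s::real in at_right 0. 0 \<le> - 2 * (\<Sum>j=p..q. z j - y j) + s * card {p..q} + lam * (eL + eR)"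
    using s0 perturb unfolding eventually_at_right_field by force
  ultimately have "0 \<le> - 2 * (\<Sum>j=p..q. z j - y j) + 0 * real (card {p..q}) + lam * (eL + eR)"
    by (rule tendsto_lowerbound) simp
  moreover have "(\<Sum>j=p..q. z i - y j) \<le> (\<Sum>j=p..q. z j - y j)"
    using pq by (intro sum_mono) auto
  ultimately have "(\<Sum>j=p..q. z i - y j) \<le> lam / 2 * (eL + eR)"
    by simp
  then show thesis
    using that p(1,2) q(1,2) unfolding eL_def eR_def by blast
qed

text \<open>
  Here \<open>L\<close> is the length of the block of \<open>tv_local_average_bound\<close> and \<open>e\<close> the total rate at its ends.
  When the penalty acts against the bound, the block is a whole piece, and its length, at least \<open>W\<close>,
  pays for \<open>lam\<close>. When it is neutral, the block is a whole piece or reaches from the index to an end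
  of the piece, hence has length at least \<open>d\<close>. When it helps, completing the square shows that its
  gain makes up for the noise on blocks of every length.
\<close>

lemma average_bound_arith:
  fixes m C lam L W d r e :: real
  assumes m: "0 < m" and C: "2 < C" and W: "W = 4 * C\<^sup>2 * r" and r: "0 < r"
    and lam: "lam = (C - 1) * m * sqrt W" and d: "0 < d" "d \<le> 4 * r" and L: "0 < L"
    and cases: "e \<le> 2 \<and> W \<le> L \<or> e \<le> 0 \<and> d \<le> L \<or> e \<le> - 1"
  shows "m * sqrt L + lam / 2 * e \<le> L * (m / sqrt d)"
proof -
  \<comment> \<open>This relation makes \<open>C * m / sqrt W = m / (2 * sqrt r)\<close>, which is at most \<open>m / sqrt d\<close>.\<close>
  have sqrtW: "sqrt W = C * (2 * sqrt r)"
    using C r by (simp add: W real_sqrt_mult)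
  have sd: "0 < sqrt d" "sqrt d \<le> 2 * sqrt r"
    using d real_sqrt_le_mono[OF d(2)] by (simp_all add: real_sqrt_mult)
  have sr: "0 < sqrt r"
    using r by simp
  have lam_pos: "0 \<le> lam"
    using m C r by (simp add: lam W)
  have LL: "L = sqrt L * sqrt L"
    using L by simp
  show ?thesis
    using cases
  proof (elim disjE conjE)
    assume e: "e \<le> 2" "W \<le> L"
    have "lam / 2 * e \<le> lam"
      using e lam_pos mult_left_mono[of e 2 "lam / 2"] by simp
    also have "\<dots> \<le> (C - 1) * m * sqrt L"
      unfolding lam using e C m by (intro mult_left_mono) auto
    finally have "m * sqrt L + lam / 2 * e \<le> m * sqrt L * C"
      by (simp add: algebra_simps)
    also have "C \<le> sqrt L / sqrt d"
    proof -
      have "C * sqrt d \<le> sqrt W"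
        unfolding sqrtW using sd C by (intro mult_left_mono) auto
      also have "\<dots> \<le> sqrt L"
        using e by simp
      finally show ?thesis
        using sd by (simp add: pos_le_divide_eq)
    qed
    then have "m * sqrt L * C \<le> m * sqrt L * (sqrt L / sqrt d)"
      using m L by (intro mult_left_mono) auto
    also have "\<dots> = L * (m / sqrt d)"
      using L by simp
    finally show ?thesis .
  next
    assume e: "e \<le> 0" "d \<le> L"
    have "lam / 2 * e \<le> 0"
      using e lam_pos by (intro mult_nonneg_nonpos) auto
    moreover have "m * sqrt L * 1 \<le> m * sqrt L * (sqrt L / sqrt d)"
      using m L e d by (intro mult_left_mono) auto
    moreover have "m * sqrt L * (sqrt L / sqrt d) = L * (m / sqrt d)"
      using L by simp
    ultimately show ?thesis
      by linarith
  next
    assume e: "e \<le> - 1"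
    have "lam / 2 * e \<le> - (lam / 2)"
      using e lam_pos mult_left_mono[of e "- 1" "lam / 2"] by simp
    moreover have "m * (sqrt d / 4) \<le> lam / 2"
    proof -
      have "1 * sqrt d \<le> (C - 1) * sqrt W"
      proof (rule mult_mono)
        have "2 * sqrt r * 1 \<le> 2 * sqrt r * C"
          using sr C by (intro mult_left_mono) auto
        with sd show "sqrt d \<le> sqrt W"
          unfolding sqrtW by (simp add: mult.commute)
      qed (use C sd in auto)
      then have "m * sqrt d \<le> m * ((C - 1) * sqrt W)"
        using m by (intro mult_left_mono) auto
      moreover have "0 \<le> m * sqrt d"
        using m sd by simp
      ultimately show ?thesis
        unfolding lam by (simp add: algebra_simps)
    qed
    moreover have "m * sqrt L \<le> m * (L / sqrt d + sqrt d / 4)"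
    proof (rule mult_left_mono)
      have "0 \<le> (sqrt L - sqrt d / 2)\<^sup>2 / sqrt d"
        using sd by simp
      also have "\<dots> = L / sqrt d + sqrt d / 4 - sqrt L"
        using sd d L by (simp add: power2_eq_square field_simps)
      finally show "sqrt L \<le> L / sqrt d + sqrt d / 4"
        by simp
    qed (use m in simp)
    ultimately show ?thesis
      by (simp add: algebra_simps)
  qed
qed

text \<open>
  The distance to an end of the piece matters only if that end is not an end of \<open>{1..n}\<close>, since
  the outer end of the first or the last piece exerts no pull.
\<close>

lemma tv_piece_upper_bound:
  fixes y z :: "nat \<Rightarrow> real" and n r W :: nat
  assumes m: "0 < m" and C: "2 < C" and W: "real W = 4 * C\<^sup>2 * real r" and r: "0 < r"
    and lam: "lam = (C - 1) * m * sqrt (real W)"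
    and min: "\<And>w. tv_objective n lam y z \<le> tv_objective n lam y w"
    and J: "1 \<le> a" "a \<le> i" "i \<le> b" "b \<le> n" and len: "W \<le> card {a..b}"
    and noise: "\<And>p q. \<lbrakk>a \<le> p; p \<le> q; q \<le> b\<rbrakk> \<Longrightarrow>
      \<bar>\<Sum>j=p..q. y j - c\<bar> \<le> m * sqrt (card {p..q})"
    and d: "0 < d" "d \<le> 4 * r" and dist: "a = 1 \<or> a + d \<le> i + 1" "b = n \<or> i + d \<le> b + 1"
  shows "z i - c \<le> m / sqrt d"
proof -
  have "0 \<le> lam"
    using m C by (simp add: lam)
  then obtain p q where pq: "a \<le> p" "p \<le> i" "i \<le> q" "q \<le> b"
    and le: "(\<Sum>j=p..q. z i - y j) \<le> lam / 2 *
      ((if a < p then - 1 else if a = 1 then 0 else 1) + (if q < b then - 1 else if b = n then 0 else 1))"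
      (is "_ \<le> _ * ?e")
    using tv_local_average_bound[OF _ min J] by blast
  define L where "L = real (card {p..q})"
  have L: "0 < L" "L = real q + 1 - real p"
    using pq by (simp_all add: L_def)
  have "L * (z i - c) = (\<Sum>j=p..q. z i - y j) + (\<Sum>j=p..q. y j - c)"
    by (simp add: L_def sum_subtractf algebra_simps del: card_atLeastAtMost)
  also have "\<dots> \<le> lam / 2 * ?e + m * sqrt L"
    using le noise[of p q] pq unfolding L_def by linarith
  also have "\<dots> \<le> L * (m / sqrt d)"
  proof -
    have "real W \<le> real b + 1 - real a"
      using len J by (simp add: of_nat_diff)
    then have "?e \<le> 2 \<and> real W \<le> L \<or> ?e \<le> 0 \<and> real d \<le> L \<or> ?e \<le> - 1"
      using pq dist J unfolding L(2) by (auto split: if_splits)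
    from average_bound_arith[OF m C W _ lam _ _ L(1) this] r d show ?thesis
      by (simp add: add.commute)
  qed
  finally show ?thesis
    using L(1) mult_le_cancel_left_pos by blast
qed

text \<open>
  The lower bound is the upper bound for the reflected data \<open>- y\<close>, whose minimizer is \<open>- z\<close>.
\<close>

lemma tv_piece_bound:
  fixes y z :: "nat \<Rightarrow> real" and n r W :: nat
  assumes m: "0 < m" and C: "2 < C" and W: "real W = 4 * C\<^sup>2 * real r" and r: "0 < r"
    and lam: "lam = (C - 1) * m * sqrt (real W)"
    and min: "\<And>w. tv_objective n lam y z \<le> tv_objective n lam y w"
    and J: "1 \<le> a" "a \<le> i" "i \<le> b" "b \<le> n" and len: "W \<le> card {a..b}"
    and noise: "\<And>p q. \<lbrakk>a \<le> p; p \<le> q; q \<le> b\<rbrakk> \<Longrightarrow>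
      \<bar>\<Sum>j=p..q. y j - c\<bar> \<le> m * sqrt (card {p..q})"
    and d: "0 < d" "d \<le> 4 * r" and dist: "a = 1 \<or> a + d \<le> i + 1" "b = n \<or> i + d \<le> b + 1"
  shows "\<bar>z i - c\<bar> \<le> m / sqrt d"
proof -
  have "z i - c \<le> m / sqrt d"
    by (rule tv_piece_upper_bound[OF assms])
  moreover have "(- z) i - (- c) \<le> m / sqrt d"
  proof (rule tv_piece_upper_bound[OF m C W r lam _ J len _ d dist])
    show "tv_objective n lam (- y) (- z) \<le> tv_objective n lam (- y) w" for w
    proof -
      have "- (- w) = w"
        by (simp add: fun_Compl_def)
      then show ?thesis
        using min[of "- w"] tv_objective_uminus[of n lam y z] tv_objective_uminus[of n lam y "- w"]
        by simp
    qed
    show "\<bar>\<Sum>j=p..q. (- y) j - (- c)\<bar> \<le> m * sqrt (card {p..q})" if "a \<le> p" "p \<le> q" "q \<le> b" for p q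
    proof -
      have "(\<Sum>j=p..q. (- y) j - (- c)) = - (\<Sum>j=p..q. y j - c)"
        by (simp add: sum_negf[symmetric])
      then show ?thesis
        using noise[OF that] by simp
    qed
  qed
  ultimately show ?thesis
    by simp
qed

section \<open>Deterministic recovery of the change points\<close>

lemma piecewise_constant_piece:
  assumes pc: "piecewise_constant n K \<nu> x" and k: "k \<in> {1..K}"
  shows "1 \<le> \<nu> k" "\<nu> k < \<nu> (k + 1)" "\<nu> (k + 1) \<le> n + 1"
    and "\<nu> k + min_piece_length K \<nu> \<le> \<nu> (k + 1)"
proof -
  have mono: "strict_mono_on {1..K} \<nu>" and ends: "\<nu> 1 = 1" "\<nu> K < n" "\<nu> (K + 1) = n + 1"
    using pc by (simp_all add: piecewise_constant_def)
  have le: "\<nu> i \<le> \<nu> j" if "i \<in> {1..K}" "j \<in> {1..K}" "i \<le> j" for i j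
    using strict_mono_on_leD[OF mono] that by blast
  show "1 \<le> \<nu> k"
    using le[of 1 k] ends k by simp
  show step: "\<nu> k < \<nu> (k + 1)"
  proof (cases "k = K")
    case False
    then show ?thesis
      using strict_mono_onD[OF mono, of k "k + 1"] k by simp
  qed (use ends in simp)
  show "\<nu> (k + 1) \<le> n + 1"
    using le[of "k + 1" K] ends k by (cases "k = K") auto
  have "min_piece_length K \<nu> \<le> \<nu> (k + 1) - \<nu> k"
    unfolding min_piece_length_def using k by (intro Min_le) auto
  with step show "\<nu> k + min_piece_length K \<nu> \<le> \<nu> (k + 1)"
    by simp
qed

lemma piecewise_constant_cover:
  assumes pc: "piecewise_constant n K \<nu> x" and K: "1 \<le> K" and i: "1 \<le> i" "i \<le> n"
  obtains k where "k \<in> {1..K}" "\<nu> k \<le> i" "i < \<nu> (k + 1)"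
proof -
  define k where "k = Max {k \<in> {1..K}. \<nu> k \<le> i}"
  have "1 \<in> {k \<in> {1..K}. \<nu> k \<le> i}"
    using pc K i by (simp add: piecewise_constant_def)
  then have "k \<in> {k \<in> {1..K}. \<nu> k \<le> i}"
    unfolding k_def by (intro Max_in) auto
  then have k: "k \<in> {1..K}" "\<nu> k \<le> i"
    by auto
  have "i < \<nu> (k + 1)"
  proof (rule ccontr)
    assume "\<not> i < \<nu> (k + 1)"
    moreover from this have "k \<noteq> K"
      using pc i by (auto simp: piecewise_constant_def)
    ultimately have "k + 1 \<in> {k \<in> {1..K}. \<nu> k \<le> i}"
      using k by auto
    then have "k + 1 \<le> k"
      unfolding k_def by (intro Max_ge) auto
    then show False
      by simp
  qed
  with k show thesis
    by (rule that)
qed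

text \<open>
  Since \<open>m / sqrt r = H / 4\<close>, two values estimated with that error differ by at most \<open>H / 2\<close> within a
  piece and by at least \<open>H / 2\<close> across a change point. Detection of \<open>\<nu> k\<close> needs the second
  inequality to be strict. As \<open>\<nu> k\<close> is the first index of its piece, the piece has \<open>r + 1\<close> indices
  up to \<open>\<nu> k + r\<close>, which gives the better error bound \<open>m / sqrt (r + 1)\<close> on the right, while on the
  left only \<open>r\<close> indices lie between \<open>\<nu> k - r\<close> and the end of its piece.
\<close>

lemma change_point_recovery:
  fixes y z :: "nat \<Rightarrow> real" and n r K W :: nat
  assumes pc: "piecewise_constant n K \<nu> x" and K: "2 \<le> K"
    and W_def: "W = min_piece_length K \<nu>" and H_def: "H = min_jump K \<nu> x" and m: "0 < m" and C: "2 < C"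
    and H: "H * sqrt (real W) = 8 * C * m" and lam: "lam = (C - 1) * m * sqrt (real W)"
    and r: "real r = real W / (4 * C\<^sup>2)" "0 < r"
    and min: "\<And>w. tv_objective n lam y z \<le> tv_objective n lam y w"
    and noise: "\<And>p q. \<lbrakk>1 \<le> p; p \<le> q; q \<le> n\<rbrakk> \<Longrightarrow>
      \<bar>\<Sum>j=p..q. y j - x j\<bar> \<le> m * sqrt (card {p..q})"
  shows "\<nu> ` {2..K} \<subseteq> est_change_points n r (H / 2) z"
    and "\<And>i. i \<in> est_change_points n r (H / 2) z \<Longrightarrow> \<exists>k\<in>{2..K}. \<bar>real i - real (\<nu> k)\<bar> \<le> 2 * real r"
proof -
  have W: "real W = 4 * C\<^sup>2 * real r"
    using r C by simp
  have Hr: "H = 4 * (m / sqrt (real r))"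
  proof -
    have "sqrt (real W) = 2 * C * sqrt (real r)"
      using C by (simp add: W real_sqrt_mult)
    then have "H * sqrt (real r) = 4 * m"
      using H C by (simp add: field_simps)
    then show ?thesis
      using r(2) by (simp add: field_simps)
  qed
  have W_large: "16 * r \<le> W"
  proof -
    have "(2::real)\<^sup>2 \<le> C\<^sup>2"
      using C by (intro power_mono) auto
    then have "16 * real r \<le> real W"
      unfolding W by (intro mult_right_mono) auto
    then show ?thesis
      by linarith
  qed
  have decr: "m / sqrt (real (r + 1)) < m / sqrt (real r)"
    using m r(2) by (intro divide_strict_left_mono) auto
  have ends: "\<nu> 1 = 1" "\<nu> (K + 1) = n + 1"
    and const: "\<And>k i. k \<in> {1..K} \<Longrightarrow> i \<in> {\<nu> k..<\<nu> (k + 1)} \<Longrightarrow> x i = x (\<nu> k)"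
    using pc unfolding piecewise_constant_def by blast+
  have piece: "\<bar>z i - x (\<nu> k)\<bar> \<le> m / sqrt (real d)"
    if k: "k \<in> {1..K}" and i: "\<nu> k \<le> i" "i < \<nu> (k + 1)" and d: "0 < d" "d \<le> 4 * r"
      and dist: "k = 1 \<or> \<nu> k + d \<le> i + 1" "k = K \<or> i + d \<le> \<nu> (k + 1)" for k i d
  proof -
    note P = piecewise_constant_piece[OF pc k, folded W_def]
    define b where "b = \<nu> (k + 1) - 1"
    have b: "\<nu> (k + 1) = b + 1"
      using P by (simp add: b_def)
    show ?thesis
    proof (rule tv_piece_bound[where a = "\<nu> k" and b = b and r = r, OF m C W r(2) lam min])
      show "\<nu> k = 1 \<or> \<nu> k + d \<le> i + 1" "b = n \<or> i + d \<le> b + 1"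
        using dist ends b by auto
      show "\<bar>\<Sum>j=p..q. y j - x (\<nu> k)\<bar> \<le> m * sqrt (card {p..q})"
        if "\<nu> k \<le> p" "p \<le> q" "q \<le> b" for p q
      proof -
        have "x j = x (\<nu> k)" if "j \<in> {p..q}" for j
          using that \<open>\<nu> k \<le> p\<close> \<open>q \<le> b\<close> b by (intro const[OF k]) auto
        then have "(\<Sum>j=p..q. y j - x (\<nu> k)) = (\<Sum>j=p..q. y j - x j)"
          by (intro sum.cong) auto
        also have "\<bar>\<dots>\<bar> \<le> m * sqrt (card {p..q})"
          using that P b by (intro noise) auto
        finally show ?thesis .
      qed
    qed (use P b i d in auto)
  qed

  show "\<nu> ` {2..K} \<subseteq> est_change_points n r (H / 2) z"
  proof (rule image_subsetI)
    fix k assume k: "k \<in> {2..K}"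
    then obtain k' where k': "k = k' + 1" "k' \<in> {1..K - 1}"
      by (cases k) auto
    have kk: "k \<in> {1..K}" "k' \<in> {1..K}"
      using k k' by auto
    note P = piecewise_constant_piece[OF pc kk(1), folded W_def]
      and P' = piecewise_constant_piece[OF pc kk(2), folded W_def k'(1)]
    have "\<bar>z (\<nu> k - r) - x (\<nu> k')\<bar> \<le> m / sqrt (real r)"
      by (rule piece[OF kk(2)]) (use P' W_large r(2) k'(1) in auto)
    moreover have "\<bar>z (\<nu> k + r) - x (\<nu> k)\<bar> \<le> m / sqrt (real (r + 1))"
      by (rule piece[OF kk(1)]) (use P W_large r(2) in auto)
    moreover have "H \<le> \<bar>x (\<nu> k') - x (\<nu> k)\<bar>"
      unfolding H_def min_jump_def k'(1) using k'(2) by (intro Min_le) auto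
    ultimately have "H / 2 < \<bar>z (\<nu> k - r) - z (\<nu> k + r)\<bar>"
      using decr Hr by linarith
    moreover have "r < \<nu> k" "\<nu> k + r \<le> n"
      using P P' W_large r(2) by auto
    ultimately show "\<nu> k \<in> est_change_points n r (H / 2) z"
      by (simp add: est_change_points_def)
  qed

  show "\<exists>k\<in>{2..K}. \<bar>real i - real (\<nu> k)\<bar> \<le> 2 * real r"
    if i: "i \<in> est_change_points n r (H / 2) z" for i
  proof (rule ccontr)
    assume "\<not> ?thesis"
    then have far: "\<nu> k + 2 * r < i \<or> i + 2 * r < \<nu> k" if "k \<in> {2..K}" for k
      using that by force
    have i: "r < i" "i + r \<le> n" "H / 2 < \<bar>z (i - r) - z (i + r)\<bar>"
      using i by (simp_all add: est_change_points_def)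
    obtain k where k: "k \<in> {1..K}" "\<nu> k \<le> i" "i < \<nu> (k + 1)"
      using piecewise_constant_cover[OF pc, of i] K i by auto
    have left: "k = 1 \<or> \<nu> k + 2 * r < i"
      using far[of k] k by (cases "k = 1") auto
    have right: "k = K \<or> i + 2 * r < \<nu> (k + 1)"
      using far[of "k + 1"] k by (cases "k = K") auto
    have "\<bar>z (i - r) - x (\<nu> k)\<bar> \<le> m / sqrt (real (r + 1))"
      by (rule piece[OF k(1)]) (use left right k i ends r(2) in auto)
    moreover have "\<bar>z (i + r) - x (\<nu> k)\<bar> \<le> m / sqrt (real (r + 1))"
      by (rule piece[OF k(1)]) (use left right k i ends r(2) in auto)
    ultimately show False
      using decr Hr i(3) by linarith
  qed
qed

section \<open>Gaussian noise on intervals\<close>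

lemma normal_density_shift_le:
  assumes "0 < \<sigma>" "0 \<le> u * x"
  shows "normal_density 0 \<sigma> (x + u) \<le> exp (- u\<^sup>2 / (2 * \<sigma>\<^sup>2)) * normal_density 0 \<sigma> x"
proof -
  have "exp (- (x + u)\<^sup>2 / (2 * \<sigma>\<^sup>2)) \<le> exp (- u\<^sup>2 / (2 * \<sigma>\<^sup>2) + - x\<^sup>2 / (2 * \<sigma>\<^sup>2))"
    unfolding exp_le_cancel_iff add_divide_distrib[symmetric]
    using assms by (intro divide_right_mono) (auto simp: power2_eq_square algebra_simps)
  then show ?thesis
    unfolding normal_density_def exp_add by (simp add: divide_right_mono mult.commute)
qed

text \<open>
  Shifting each tail by \<open>u\<close> towards the origin gains the factor \<open>exp (- u\<^sup>2 / (2 * \<sigma>\<^sup>2))\<close>, and the two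
  shifted tails fill the two half-lines, of total mass \<open>1\<close>. This avoids the factor \<open>2\<close> of the Chernoff
  bound, so that the crude count of \<open>n\<^sup>2\<close> intervals suffices for the union bound.
\<close>

lemma (in prob_space) normal_tail_bound:
  assumes X: "distributed M lborel X (normal_density 0 \<sigma>)" and pos: "0 < \<sigma>" "0 \<le> u"
  shows "\<P>(\<omega> in M. u < \<bar>X \<omega>\<bar>) \<le> exp (- u\<^sup>2 / (2 * \<sigma>\<^sup>2))"
proof -
  let ?\<phi> = "\<lambda>x. ennreal (normal_density 0 \<sigma> x)" and ?c = "exp (- u\<^sup>2 / (2 * \<sigma>\<^sup>2))"
  have right: "(\<integral>\<^sup>+x. ?\<phi> x * indicator {u<..} x \<partial>lborel)
      \<le> ?c * (\<integral>\<^sup>+x. ?\<phi> x * indicator {0<..} x \<partial>lborel)"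
  proof -
    have "(\<integral>\<^sup>+x. ?\<phi> x * indicator {u<..} x \<partial>lborel)
        = (\<integral>\<^sup>+x. ?\<phi> (x + u) * indicator {u<..} (x + u) \<partial>lborel)"
      using nn_integral_real_affine[of "\<lambda>x. ?\<phi> x * indicator {u<..} x" 1 u]
      by (simp add: add.commute)
    also have "\<dots> \<le> (\<integral>\<^sup>+x. ?c * (?\<phi> x * indicator {0<..} x) \<partial>lborel)"
      using pos normal_density_shift_le[OF pos(1), of u] by (intro nn_integral_mono)
        (auto simp: indicator_def ennreal_mult'[symmetric] intro!: ennreal_leI)
    finally show ?thesis
      by (simp add: nn_integral_cmult)
  qed
  have left: "(\<integral>\<^sup>+x. ?\<phi> x * indicator {..<- u} x \<partial>lborel)
      \<le> ?c * (\<integral>\<^sup>+x. ?\<phi> x * indicator {..<0} x \<partial>lborel)"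
  proof -
    have "(\<integral>\<^sup>+x. ?\<phi> x * indicator {..<- u} x \<partial>lborel)
        = (\<integral>\<^sup>+x. ?\<phi> (x + - u) * indicator {..<- u} (x + - u) \<partial>lborel)"
      using nn_integral_real_affine[of "\<lambda>x. ?\<phi> x * indicator {..<- u} x" 1 "- u"]
      by (simp add: add.commute)
    also have "\<dots> \<le> (\<integral>\<^sup>+x. ?c * (?\<phi> x * indicator {..<0} x) \<partial>lborel)"
      using pos normal_density_shift_le[OF pos(1), of "- u"] by (intro nn_integral_mono)
        (auto simp: indicator_def ennreal_mult'[symmetric] mult_nonneg_nonpos intro!: ennreal_leI)
    finally show ?thesis
      by (simp add: nn_integral_cmult)
  qed
  have "emeasure M {\<omega> \<in> space M. u < \<bar>X \<omega>\<bar>} = emeasure M (X -` ({u<..} \<union> {..<- u}) \<inter> space M)"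
    by (intro arg_cong[where f = "emeasure M"]) auto
  also have "\<dots> = (\<integral>\<^sup>+x. ?\<phi> x * indicator ({u<..} \<union> {..<- u}) x \<partial>lborel)"
    by (rule distributed_emeasure[OF X]) auto
  also have "\<dots> = (\<integral>\<^sup>+x. ?\<phi> x * indicator {u<..} x + ?\<phi> x * indicator {..<- u} x \<partial>lborel)"
    using pos by (intro nn_integral_cong) (auto simp: indicator_def)
  also have "\<dots> = (\<integral>\<^sup>+x. ?\<phi> x * indicator {u<..} x \<partial>lborel)
      + (\<integral>\<^sup>+x. ?\<phi> x * indicator {..<- u} x \<partial>lborel)"
    by (intro nn_integral_add) auto
  also have "\<dots> \<le> ?c * (\<integral>\<^sup>+x. ?\<phi> x * indicator {0<..} x \<partial>lborel)
      + ?c * (\<integral>\<^sup>+x. ?\<phi> x * indicator {..<0} x \<partial>lborel)"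
    by (rule add_mono[OF right left])
  also have "\<dots> = ?c * (\<integral>\<^sup>+x. ?\<phi> x * indicator {0<..} x + ?\<phi> x * indicator {..<0} x \<partial>lborel)"
    by (subst nn_integral_add) (auto simp: distrib_left)
  also have "\<dots> \<le> ?c * (\<integral>\<^sup>+x. ?\<phi> x \<partial>lborel)"
    by (intro mult_left_mono nn_integral_mono) (auto simp: indicator_def)
  also have "(\<integral>\<^sup>+x. ?\<phi> x \<partial>lborel) = 1"
    using prob_space.emeasure_space_1[OF prob_space_normal_density[OF pos(1), of 0]]
    by (simp add: emeasure_density)
  finally show ?thesis
    by (simp add: emeasure_eq_measure)
qed

lemma (in prob_space) interval_noise_bound:
  fixes \<epsilon> :: "nat \<Rightarrow> 'a \<Rightarrow> real"
  assumes indep: "indep_vars (\<lambda>_. borel) \<epsilon> {1..n}"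
    and normal: "\<And>i. i \<in> {1..n} \<Longrightarrow> distributed M lborel (\<epsilon> i) (normal_density 0 \<sigma>)"
    and \<sigma>: "0 < \<sigma>" and n: "1 \<le> n" and t: "1 \<le> t"
    and m: "m = 2 * \<sigma> * sqrt (ln (real n) + ln t)"
  shows "1 - 1 / t\<^sup>2 \<le> \<P>(\<omega> in M. \<forall>p\<in>{1..n}. \<forall>q\<in>{p..n}.
    \<bar>\<Sum>i=p..q. \<epsilon> i \<omega>\<bar> \<le> m * sqrt (card {p..q}))"
proof -
  define I where "I = Sigma {1..n} (\<lambda>p. {p..n})"
  define Bad where "Bad = (\<lambda>pq. {\<omega> \<in> space M.
    \<not> \<bar>\<Sum>i=fst pq..snd pq. \<epsilon> i \<omega>\<bar> \<le> m * sqrt (card {fst pq..snd pq})})"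
  have ln: "0 \<le> ln (real n) + ln t"
    using n t by simp
  have I: "finite I" "card I \<le> n\<^sup>2"
  proof -
    have sub: "I \<subseteq> {1..n} \<times> {1..n}"
      by (auto simp: I_def)
    then show "finite I"
      by (rule finite_subset) simp
    show "card I \<le> n\<^sup>2"
      using card_mono[OF _ sub] by (simp add: power2_eq_square)
  qed
  have bad: "Bad pq \<in> sets M \<and> measure M (Bad pq) \<le> 1 / (real n * t)\<^sup>2" if "pq \<in> I" for pq
  proof -
    obtain p q where "pq = (p, q)"
      by (cases pq)
    with that have pq: "pq = (p, q)" "1 \<le> p" "p \<le> q" "q \<le> n"
      by (auto simp: I_def)
    define s where "s = sqrt (\<Sum>i=p..q. \<sigma>\<^sup>2)"
    have s2: "s\<^sup>2 = card {p..q} * \<sigma>\<^sup>2"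
      unfolding s_def by simp
    have D: "distributed M lborel (\<lambda>\<omega>. \<Sum>i=p..q. \<epsilon> i \<omega>) (normal_density (\<Sum>i=p..q. 0) s)"
      unfolding s_def using pq \<sigma>
      by (intro sum_indep_normal indep_vars_subset[OF indep] normal) auto
    then have [measurable]: "(\<lambda>\<omega>. \<Sum>i=p..q. \<epsilon> i \<omega>) \<in> borel_measurable M"
      by (auto dest: distributed_measurable)
    have pos: "0 < s"
      using s_def \<sigma> pq by simp
    have "measure M (Bad pq) \<le> exp (- (m * sqrt (card {p..q}))\<^sup>2 / (2 * s\<^sup>2))"
      using normal_tail_bound[of "\<lambda>\<omega>. \<Sum>i=p..q. \<epsilon> i \<omega>" s "m * sqrt (card {p..q})"] D pos ln \<sigma>
      by (simp add: Bad_def pq(1) m not_le)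
    also have "- (m * sqrt (card {p..q}))\<^sup>2 / (2 * s\<^sup>2) = - 2 * ln (real n * t)"
    proof -
      have "(m * sqrt (card {p..q}))\<^sup>2 = 4 * \<sigma>\<^sup>2 * ln (real n * t) * card {p..q}"
        unfolding m power_mult_distrib using ln n t by (simp add: ln_mult)
      moreover have "0 < real (card {p..q})"
        using pq by simp
      ultimately show ?thesis
        unfolding s2 using \<sigma> pq(3) by (simp del: card_atLeastAtMost)
    qed
    also have "exp (- 2 * ln (real n * t)) = 1 / (real n * t)\<^sup>2"
    proof -
      have "2 * ln (real n * t) = ln ((real n * t)\<^sup>2)"
        using n t by (subst ln_realpow) auto
      moreover have "0 < (real n * t)\<^sup>2"
        using n t by simp
      ultimately show ?thesis
        by (simp add: exp_minus inverse_eq_divide)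
    qed
    finally show ?thesis
      by (simp add: Bad_def pq(1) not_le)
  qed
  have "measure M (\<Union>pq\<in>I. Bad pq) \<le> (\<Sum>pq\<in>I. measure M (Bad pq))"
    using I bad by (intro finite_measure_subadditive_finite) auto
  also have "\<dots> \<le> card I * (1 / (real n * t)\<^sup>2)"
    using bad by (intro sum_bounded_above) auto
  also have "\<dots> \<le> n\<^sup>2 * (1 / (real n * t)\<^sup>2)"
    using I(2) by (intro mult_right_mono) (auto simp del: of_nat_power)
  also have "\<dots> = 1 / t\<^sup>2"
    using n t by (simp add: field_simps)
  finally have "1 - 1 / t\<^sup>2 \<le> 1 - measure M (\<Union>pq\<in>I. Bad pq)"
    by simp
  also have "\<dots> = measure M (space M - (\<Union>pq\<in>I. Bad pq))"
    using I bad by (intro prob_compl[symmetric] sets.finite_UN) auto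
  also have "space M - (\<Union>pq\<in>I. Bad pq) = {\<omega> \<in> space M. \<forall>p\<in>{1..n}. \<forall>q\<in>{p..n}.
      \<bar>\<Sum>i=p..q. \<epsilon> i \<omega>\<bar> \<le> m * sqrt (card {p..q})}"
    unfolding I_def Bad_def by (auto simp del: not_le card_atLeastAtMost)
  finally show ?thesis .
qed

section \<open>The Hausdorff distance bound\<close>

lemma one_sided_dist_le:
  assumes "finite A" "finite B" "B \<noteq> {}" "\<And>b. b \<in> B \<Longrightarrow> \<exists>a\<in>A. \<bar>real a - real b\<bar> \<le> c"
  shows "one_sided_dist A B \<le> c"
  unfolding one_sided_dist_def
proof (rule Max.boundedI)
  fix v assume "v \<in> (\<lambda>b. Min ((\<lambda>a. \<bar>real a - real b\<bar>) ` A)) ` B"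
  then obtain b where b: "b \<in> B" "v = Min ((\<lambda>a. \<bar>real a - real b\<bar>) ` A)"
    by auto
  then obtain a where a: "a \<in> A" "\<bar>real a - real b\<bar> \<le> c"
    using assms(4) by blast
  then have "v \<le> \<bar>real a - real b\<bar>"
    unfolding b(2) using assms(1) by (intro Min_le) auto
  with a show "v \<le> c"
    by simp
qed (use assms in auto)

theorem corollary3p3:
  fixes M :: "'a measure" and \<epsilon> :: "nat \<Rightarrow> 'a \<Rightarrow> real"
    and \<sigma> t C My H lam :: real and n K W r :: nat
    and \<nu> :: "nat \<Rightarrow> nat" and x :: "nat \<Rightarrow> real"
    and y xhat :: "'a \<Rightarrow> nat \<Rightarrow> real"
    and S :: "nat set" and Shat :: "'a \<Rightarrow> nat set"
  assumes "prob_space M"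
    and "\<sigma> > 0" and "t \<ge> 1" and "K \<ge> 2"
    and "prob_space.indep_vars M (\<lambda>_. borel) \<epsilon> {1..n}"
    and "\<And>i. i \<in> {1..n} \<Longrightarrow> distributed M lborel (\<epsilon> i) (normal_density 0 \<sigma>)"
    and "piecewise_constant n K \<nu> x"
    and "\<And>\<omega> i. y \<omega> i = x i + \<epsilon> i \<omega>"
    and "My = 2 * \<sigma> * sqrt (ln (real n) + ln t)"
    and "W = min_piece_length K \<nu>"
    and "H = min_jump K \<nu> x"
    and "H * sqrt (real W) > 16 * My"
    and "H * sqrt (real W) = 8 * C * My"
    and "lam = (C - 1) * My * sqrt (real W)"
    and "\<And>\<omega>. xhat \<omega> = tv_minimizer n lam (y \<omega>)"
    and "S = \<nu> ` {2..K}"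
    and "real r = real W / (4 * C\<^sup>2)" and "r > 0"
    and "\<And>\<omega>. Shat \<omega> = est_change_points n r (H / 2) (xhat \<omega>)"
  shows "measure M {\<omega> \<in> space M. Shat \<omega> \<noteq> {} \<and>
             hausdorff_dist (Shat \<omega>) S \<le> real W / (2 * C\<^sup>2)} \<ge> 1 - 1 / t\<^sup>2
         \<and> real W / (2 * C\<^sup>2) = 32 * My\<^sup>2 / H\<^sup>2"
proof -
  interpret prob_space M
    by fact
  note \<sigma> = assms(2) and t = assms(3) and K = assms(4) and pc = assms(7) and y = assms(8)
    and My = assms(9) and W = assms(10) and H = assms(11) and HC = assms(13) and lam = assms(14)
    and xhat = assms(15) and S = assms(16) and r = assms(17,18) and Shat = assms(19)
  have n: "1 < n"
    using piecewise_constant_piece(1)[OF pc, of K] K pc by (auto simp: piecewise_constant_def)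
  have My_pos: "0 < My"
    unfolding My using n t \<sigma> by (intro mult_pos_pos) (auto intro!: add_pos_nonneg)
  have C: "2 < C"
    using assms(12) HC My_pos by simp
  have W_pos: "0 < real W"
    using r by (cases "W = 0") auto
  have H_pos: "0 < H"
  proof -
    have "0 < H * sqrt (real W)"
      using HC C My_pos by simp
    then show ?thesis
      using W_pos by (simp add: zero_less_mult_iff)
  qed
  have lam_nonneg: "0 \<le> lam"
    unfolding lam using C My_pos by simp
  have radius: "real W / (2 * C\<^sup>2) = 2 * real r"
    using r by simp

  define Good where "Good = {\<omega> \<in> space M. \<forall>p\<in>{1..n}. \<forall>q\<in>{p..n}.
    \<bar>\<Sum>i=p..q. \<epsilon> i \<omega>\<bar> \<le> My * sqrt (card {p..q})}"
  define Event where "Event = {\<omega> \<in> space M. Shat \<omega> \<noteq> {} \<and>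
    hausdorff_dist (Shat \<omega>) S \<le> real W / (2 * C\<^sup>2)}"
  have "1 - 1 / t\<^sup>2 \<le> measure M Good"
    unfolding Good_def using n by (intro interval_noise_bound[OF assms(5,6) \<sigma> _ t My]) auto
  also have "\<dots> \<le> measure M Event"
  proof (rule finite_measure_mono)
    show "Good \<subseteq> Event"
    proof
      fix \<omega> assume \<omega>: "\<omega> \<in> Good"
      have noise: "\<bar>\<Sum>j=p..q. y \<omega> j - x j\<bar> \<le> My * sqrt (card {p..q})"
        if "1 \<le> p" "p \<le> q" "q \<le> n" for p q
        using \<omega> that by (auto simp: Good_def y)
      have min: "tv_objective n lam (y \<omega>) (xhat \<omega>) \<le> tv_objective n lam (y \<omega>) w" for w
        unfolding xhat by (rule tv_minimizer_le[OF lam_nonneg])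
      have detected: "S \<subseteq> Shat \<omega>"
        unfolding S Shat
        by (rule change_point_recovery(1)[OF pc K W H My_pos C HC lam r min]) (rule noise)
      have near: "\<exists>k\<in>{2..K}. \<bar>real i - real (\<nu> k)\<bar> \<le> 2 * real r" if "i \<in> Shat \<omega>" for i
        by (rule change_point_recovery(2)[OF pc K W H My_pos C HC lam r min])
          (use noise that in \<open>simp_all add: Shat\<close>)
      have fin: "finite S" "finite (Shat \<omega>)" "S \<noteq> {}"
        using K by (auto simp: S Shat est_change_points_def intro: finite_subset[of _ "{..n}"])
      have "Shat \<omega> \<noteq> {}"
        using detected fin by auto
      moreover have "one_sided_dist (Shat \<omega>) S \<le> 2 * real r"
        using detected fin by (intro one_sided_dist_le) (auto intro!: bexI)
      moreover have "one_sided_dist S (Shat \<omega>) \<le> 2 * real r"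
        using near fin \<open>Shat \<omega> \<noteq> {}\<close>
        by (intro one_sided_dist_le) (auto simp: S abs_minus_commute)
      ultimately show "\<omega> \<in> Event"
        using \<omega> unfolding Event_def radius by (simp add: Good_def hausdorff_dist_def)
    qed
    have "(\<lambda>\<omega>. y \<omega> j) \<in> borel_measurable M" if "j \<in> {1..n}" for j
      using distributed_measurable[OF assms(6)[OF that]] unfolding y by simp
    then show "Event \<in> sets M"
      unfolding Event_def Shat xhat by (intro measurable_est_change_points[OF lam_nonneg])
  qed
  finally have "1 - 1 / t\<^sup>2 \<le> measure M Event" .
  moreover have "real W / (2 * C\<^sup>2) = 32 * My\<^sup>2 / H\<^sup>2"
  proof -
    have "H\<^sup>2 * real W = (8 * C * My)\<^sup>2"
      using HC[symmetric] by (simp add: power_mult_distrib)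
    then show ?thesis
      using H_pos C by (simp add: field_simps power_mult_distrib)
  qed
  ultimately show ?thesis
    unfolding Event_def by blast
qed

end
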